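(* For $m\ge 1$, $1\le i\le 2^m$ and an integer $d\ge 0$ let $P(m,i,d)=\Pr\left(w(g_{2^m}^{(i)})=d\right)$, the probability being over the random matrix $T$. Then the following hold. (a) For $m\ge 2$ and $1\le i\le 2^{m-1}$, $$P(m,i,d)=\sum_{\substack{d'=w(f_{2^m}^{(i)})\\ d-d'\text{ even}}}^{d}P(m-1,i,d')\,\frac{2^{d'}\binom{2^{m-1}-d'}{(d-d')/2}}{2^{2^{m-1}}}.$$ (b) For $m\ge 2$ and $2^{m-1}<i\le 2^m$, $$P(m,i,d)=\begin{cases}P(m-1,i-2^{m-1},d/2), & d\text{ even},\\ 0, & d\text{ odd}.\end{cases}$$ (c) $P(1,1,1)=P(1,2,2)=1$. (d) For $m\ge1$: $P(m,1,d)=0$ if $d$ is even, and $P(m,i,d)=0$ if $i>1$ and $d$ is odd.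
   Context: All vectors and matrices are over $\mathbb{F}_2$; $w(\cdot)$ denotes Hamming weight. Let $F=\begin{bmatrix}1&0\\1&1\end{bmatrix}$, $N=2^m$, and $F_N=F^{\otimes m}$ (Kronecker power). For $1\le i\le N$, $f_N^{(i)}$ is the $i$-th row of $F_N$. For each $m$, $T$ is a random $N\times N$ upper-triangular matrix over $\mathbb{F}_2$ with all ones on the diagonal, whose entries $T_{ij}$, $1\le i<j\le N$, are i.i.d. Bernoulli$(1/2)$. Let $g_N^{(i)}$ be the $i$-th row of $G_N=TF_N$, so $g_N^{(i)}=f_N^{(i)}\oplus\sum_{j=i+1}^{N}T_{ij}f_N^{(j)}$. An empty sum is $0$, and a binomial coefficient $\binom{a}{b}$ with $a<0$ or $b>a$ is taken to be $0$. *)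

theory Defs
  imports
    "HOL-Library.Z2"
    "HOL-Probability.Probability"
    "HOL-Probability.Product_PMF"
    "Jordan_Normal_Form.Matrix"
begin

definition kronecker_mat :: "'a::semiring_1 mat \<Rightarrow> 'a mat \<Rightarrow> 'a mat" where
  "kronecker_mat A B =
     mat (dim_row A * dim_row B) (dim_col A * dim_col B)
       (\<lambda>(r, c). A $$ (r div dim_row B, c div dim_col B) * B $$ (r mod dim_row B, c mod dim_col B))"

primrec kronecker_power :: "'a::semiring_1 mat \<Rightarrow> nat \<Rightarrow> 'a mat" where
  "kronecker_power A 0 = 1\<^sub>m 1"
| "kronecker_power A (Suc m) = kronecker_mat A (kronecker_power A m)"

definition hamming_weight :: "'a::zero vec \<Rightarrow> nat" where
  "hamming_weight v = card {k. k < dim_vec v \<and> v $ k \<noteq> 0}"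

definition polar_kernel :: "bit mat" where
  "polar_kernel = mat_of_rows_list 2 [[1, 0], [1, 1]]"

definition polar_mat :: "nat \<Rightarrow> bit mat" where
  "polar_mat m = kronecker_power polar_kernel m"

text \<open>Matrix entries are indexed from 0, whereas the row numbers \<open>i\<close> in
  \<open>polar_row\<close> and \<open>weight_prob\<close> below range over \<open>1, \<dots>, 2 ^ m\<close>.\<close>

definition polar_row :: "nat \<Rightarrow> nat \<Rightarrow> bit vec" where
  "polar_row m i = row (polar_mat m) (i - 1)"

definition unitriangular_mat :: "nat \<Rightarrow> (nat \<times> nat \<Rightarrow> 'a::zero_neq_one) \<Rightarrow> 'a mat" where
  "unitriangular_mat N t =
     mat N N (\<lambda>(r, c). if r = c then 1 else if r < c then t (r, c) else 0)"

text \<open>The entries strictly above the diagonal are drawn from the product of fair coins;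
  the 0 passed to \<open>Pi_pmf\<close> is only its default value outside that index set.\<close>

definition random_unitriangular :: "nat \<Rightarrow> bit mat pmf" where
  "random_unitriangular N =
     map_pmf (unitriangular_mat N)
       (Pi_pmf {(r, c). r < c \<and> c < N} 0 (\<lambda>_. map_pmf of_bool (bernoulli_pmf (1 / 2))))"

definition weight_prob :: "nat \<Rightarrow> nat \<Rightarrow> nat \<Rightarrow> real" where
  "weight_prob m i d =
     measure_pmf.prob (random_unitriangular (2 ^ m))
       {T. hamming_weight (row (T * polar_mat m) (i - 1)) = d}"

text \<open>The upper argument is an integer so that a negative one yields 0 instead of being
  truncated to 0, where \<open>0 choose 0 = 1\<close>.\<close>

definition binom :: "int \<Rightarrow> nat \<Rightarrow> nat" where
  "binom a b = (if a < 0 then 0 else nat a choose b)"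

end

(* Row i of a random T is uniform on the binary vectors whose first 1 is at position i,
   so every probability is a count. Splitting such a vector of length 2^(m+1) into halves
   y, z turns the encoding x F_(2N) into (y F_N + z F_N, z F_N), where v = z F_N ranges
   bijectively over all vectors when i is at most N, and y = 0 otherwise. Finally w(a + v) + w(v) equals
   w(a) + 2 * (number of ones of v outside the support of a), which is what the
   binomial coefficients count. *)
theory Submission
  imports Defs
begin

unbundle no vec_syntax

section \<open>Supports and Hamming weights of binary vectors\<close>

definition vec_support :: "'a::zero vec \<Rightarrow> nat set" where
  "vec_support v = {k. k < dim_vec v \<and> v $ k \<noteq> 0}"

lemma hamming_weight_support: "hamming_weight v = card (vec_support v)"
  by (simp add: hamming_weight_def vec_support_def)

lemma finite_vec_support [simp]: "finite (vec_support v)"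
  by (simp add: vec_support_def)

lemma vec_support_subset: "v \<in> carrier_vec n \<Longrightarrow> vec_support v \<subseteq> {..<n}"
  by (auto simp: vec_support_def)

text \<open>A \<open>bit\<close> has only one nonzero value, so a binary vector is determined by its
  support. This turns the counting of vectors into the counting of subsets.\<close>

lemma bij_betw_vec_support:
  "bij_betw vec_support (carrier_vec n :: bit vec set) (Pow {..<n})"
proof (rule bij_betw_byWitness[where f' = "\<lambda>S. vec n (\<lambda>k. of_bool (k \<in> S))"])
  show "\<forall>v\<in>carrier_vec n. vec n (\<lambda>k. of_bool (k \<in> vec_support v)) = (v :: bit vec)"
    by (auto simp: vec_support_def intro!: eq_vecI)
  show "\<forall>S\<in>Pow {..<n}. vec_support (vec n (\<lambda>k. of_bool (k \<in> S)) :: bit vec) = S"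
    by (auto simp: vec_support_def)
qed (auto simp: vec_support_def)

lemma finite_carrier_bit_vec [simp]: "finite (carrier_vec n :: bit vec set)"
  using bij_betw_finite[OF bij_betw_vec_support, of n] by simp

lemma card_carrier_bit_vec: "card (carrier_vec n :: bit vec set) = 2 ^ n"
  using bij_betw_same_card[OF bij_betw_vec_support, of n] by (simp add: card_Pow)

lemma hamming_weight_le: "v \<in> carrier_vec n \<Longrightarrow> hamming_weight v \<le> n"
  using card_mono[OF _ vec_support_subset, of n v] by (simp add: hamming_weight_support)

lemma hamming_weight_append:
  "hamming_weight (v @\<^sub>v w) = hamming_weight v + hamming_weight w"
proof -
  have "vec_support (v @\<^sub>v w) = vec_support v \<union> (\<lambda>k. dim_vec v + k) ` vec_support w"
  proof (intro equalityI subsetI)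
    fix k assume k: "k \<in> vec_support (v @\<^sub>v w)"
    show "k \<in> vec_support v \<union> (\<lambda>k. dim_vec v + k) ` vec_support w"
    proof (cases "k < dim_vec v")
      case False
      then have "k - dim_vec v \<in> vec_support w" "k = dim_vec v + (k - dim_vec v)"
        using k by (auto simp: vec_support_def)
      then show ?thesis by blast
    qed (use k in \<open>auto simp: vec_support_def\<close>)
  qed (auto simp: vec_support_def)
  moreover have "vec_support v \<inter> (\<lambda>k. dim_vec v + k) ` vec_support w = {}"
    by (auto simp: vec_support_def)
  ultimately show ?thesis
    by (simp add: hamming_weight_support card_Un_disjoint card_image)
qed

lemma add_right_cancel_vec:
  fixes a b c :: "'a::cancel_semigroup_add vec"
  assumes "a \<in> carrier_vec n" "b \<in> carrier_vec n" "c \<in> carrier_vec n" "a + c = b + c"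
  shows "a = b"
proof (rule eq_vecI)
  fix k assume "k < dim_vec b"
  then show "a $ k = b $ k"
    using arg_cong[OF assms(4), of "\<lambda>v. v $ k"] assms(1-3) by simp
qed (use assms in auto)

lemma vec_support_add_bit:
  fixes a v :: "bit vec"
  assumes "a \<in> carrier_vec n" "v \<in> carrier_vec n"
  shows "vec_support (a + v) = (vec_support a - vec_support v) \<union> (vec_support v - vec_support a)"
proof -
  have "(x + y \<noteq> 0) \<longleftrightarrow> (x \<noteq> 0) \<noteq> (y \<noteq> 0)" for x y :: bit
    by (cases x; cases y) auto
  then show ?thesis using assms by (auto simp: vec_support_def simp del: bit_not_zero_iff)
qed

text \<open>With A and S the supports of \<open>a\<close> and \<open>v\<close>, the support of the
  sum is the symmetric difference. The overlap of A and S that is lost in w(a + v) is restored by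
  w(v), while S - A is counted in both. This identity underlies the count, the lower bound and the
  parity results below.\<close>

lemma hamming_weight_add_bit:
  fixes a v :: "bit vec"
  assumes "a \<in> carrier_vec n" "v \<in> carrier_vec n"
  shows "hamming_weight (a + v) + hamming_weight v
    = hamming_weight a + 2 * card (vec_support v - vec_support a)"
proof -
  let ?A = "vec_support a" and ?S = "vec_support v"
  have "hamming_weight (a + v) = card (?A - ?S) + card (?S - ?A)"
    unfolding hamming_weight_support vec_support_add_bit[OF assms]
    by (rule card_Un_disjoint) auto
  moreover have "card ?A = card (?A \<inter> ?S) + card (?A - ?S)"
    "card ?S = card (?A \<inter> ?S) + card (?S - ?A)"
    using card_Int_Diff[of ?A ?S] card_Int_Diff[of ?S ?A] by (simp_all add: Int_commute)
  ultimately show ?thesis by (simp add: hamming_weight_support)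
qed

text \<open>A subset of \<open>B\<close> splits into its part inside \<open>A\<close>, which is
  arbitrary, and its part outside \<open>A\<close>, which must have exactly \<open>k\<close>
  elements. The two choices are independent.\<close>

lemma card_subsets_Diff_card:
  assumes "finite B" "A \<subseteq> B"
  shows "card {S. S \<subseteq> B \<and> card (S - A) = k} = 2 ^ card A * ((card B - card A) choose k)"
proof -
  have "bij_betw (\<lambda>S. (S \<inter> A, S - A)) {S. S \<subseteq> B \<and> card (S - A) = k}
      (Pow A \<times> {S. S \<subseteq> B - A \<and> card S = k})"
  proof (rule bij_betw_byWitness[where f' = "\<lambda>(S, S'). S \<union> S'"], goal_cases)
    case 4
    have "(S \<union> S') - A = S'" if "S \<subseteq> A" "S' \<subseteq> B - A" for S S' using that by auto
    then show ?case using assms by (auto intro: subsetD)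
  qed (use assms in auto)
  then have "card {S. S \<subseteq> B \<and> card (S - A) = k}
      = card (Pow A \<times> {S. S \<subseteq> B - A \<and> card S = k})"
    by (rule bij_betw_same_card)
  then show ?thesis
    using assms
    by (simp add: card_cartesian_product card_Pow n_subsets card_Diff_subset finite_subset[of A B])
qed

text \<open>By \<open>hamming_weight_add_bit\<close> the condition says that \<open>v\<close> has
  exactly (d - w(a))/2 ones outside the support of \<open>a\<close>, which is impossible unless d -
  w(a) is even and nonnegative. The number of such supports is known from
  \<open>card_subsets_Diff_card\<close>.\<close>

lemma card_add_weight_eq:
  fixes a :: "bit vec"
  assumes a: "a \<in> carrier_vec n"
  shows "card {v \<in> carrier_vec n. hamming_weight (a + v) + hamming_weight v = d} =
    (if hamming_weight a \<le> d \<and> even (d - hamming_weight a)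
     then 2 ^ hamming_weight a * ((n - hamming_weight a) choose ((d - hamming_weight a) div 2)) else 0)"
proof (cases "hamming_weight a \<le> d \<and> even (d - hamming_weight a)")
  case True
  let ?A = "vec_support a" and ?k = "(d - hamming_weight a) div 2"
  have "{v \<in> carrier_vec n. hamming_weight (a + v) + hamming_weight v = d}
      = {v \<in> carrier_vec n. card (vec_support v - ?A) = ?k}"
    using True by (auto simp: hamming_weight_add_bit[OF a])
  moreover have "bij_betw vec_support {v \<in> carrier_vec n. card (vec_support (v :: bit vec) - ?A) = ?k}
      {S. S \<in> Pow {..<n} \<and> card (S - ?A) = ?k}"
    using bij_betw_vec_support[of n] by (rule bij_betw_Collect) simp
  ultimately have "card {v \<in> carrier_vec n. hamming_weight (a + v) + hamming_weight v = d}
      = card {S. S \<subseteq> {..<n} \<and> card (S - ?A) = ?k}"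
    by (simp add: bij_betw_same_card)
  also have "\<dots> = 2 ^ card ?A * ((n - card ?A) choose ?k)"
    using card_subsets_Diff_card[of "{..<n}" ?A ?k] vec_support_subset[OF a] by simp
  finally show ?thesis by (subst if_P[OF True]) (simp add: hamming_weight_support)
next
  case False
  then have "{v \<in> carrier_vec n. hamming_weight (a + v) + hamming_weight v = d} = {}"
    by (auto simp: hamming_weight_add_bit[OF a])
  then show ?thesis using False by (auto simp del: Collect_empty_eq)
qed

section \<open>The possible rows of a unitriangular matrix, and their halves\<close>

definition leading_one_vecs :: "nat \<Rightarrow> nat \<Rightarrow> bit vec set" where
  "leading_one_vecs N r = {x \<in> carrier_vec N. x $ r = 1 \<and> (\<forall>j<r. x $ j = 0)}"

lemma leading_one_vecs_carrier: "leading_one_vecs N r \<subseteq> carrier_vec N"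
  by (auto simp: leading_one_vecs_def)

lemma finite_leading_one_vecs [simp]: "finite (leading_one_vecs N r)"
  using leading_one_vecs_carrier finite_carrier_bit_vec by (rule finite_subset)

lemma unit_vec_leading_one: "r < N \<Longrightarrow> unit_vec N r \<in> leading_one_vecs N r"
  by (auto simp: leading_one_vecs_def unit_vec_def)

text \<open>A leading one in the first half puts no constraint on the second half.\<close>

lemma leading_one_vecs_append_low:
  assumes "r < M" "y \<in> carrier_vec M" "z \<in> carrier_vec M"
  shows "y @\<^sub>v z \<in> leading_one_vecs (M + M) r \<longleftrightarrow> y \<in> leading_one_vecs M r"
  using assms by (auto simp: leading_one_vecs_def)

text \<open>A leading one in the second half forces the whole first half to vanish.\<close>

lemma leading_one_vecs_high:
  assumes "r < M"
  shows "leading_one_vecs (M + M) (M + r) = (\<lambda>z. 0\<^sub>v M @\<^sub>v z) ` leading_one_vecs M r"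
proof (intro equalityI subsetI)
  fix x assume x: "x \<in> leading_one_vecs (M + M) (M + r)"
  then have xc: "x \<in> carrier_vec (M + M)" by (simp add: leading_one_vecs_def)
  have "x = vec_first x M @\<^sub>v vec_last x M" using xc by simp
  moreover have "vec_first x M = 0\<^sub>v M"
    using x by (auto simp: leading_one_vecs_def vec_first_def)
  moreover have "vec_last x M \<in> leading_one_vecs M r"
    using x assms by (auto simp: leading_one_vecs_def vec_last_def)
  ultimately show "x \<in> (\<lambda>z. 0\<^sub>v M @\<^sub>v z) ` leading_one_vecs M r" by auto
qed (use assms in \<open>auto simp: leading_one_vecs_def\<close>)

section \<open>The distribution of a single row of the random matrix\<close>

lemma bernoulli_half_bit:
  "map_pmf of_bool (bernoulli_pmf (1 / 2)) = pmf_of_set (UNIV :: bit set)"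
proof -
  have "bij_betw (of_bool :: bool \<Rightarrow> bit) UNIV UNIV"
    by (rule bij_betw_byWitness[where f' = "\<lambda>b. b = 1"]) auto
  then show ?thesis
    by (simp add: bernoulli_pmf_half_conv_pmf_of_set map_pmf_of_set_bij_betw)
qed

lemma finite_bit: "finite (UNIV :: bit set)"
proof -
  have "(UNIV :: bit set) = {0, 1}" by auto
  then show ?thesis by (metis finite.simps)
qed

text \<open>Row \<open>r\<close> depends only on the coins to the right of the diagonal in that row.
  The marginal on those positions is again a product of uniform bits, hence uniform on a finite set
  of functions, and these functions correspond bijectively to the possible rows.\<close>

lemma row_random_unitriangular:
  assumes r: "r < N"
  shows "map_pmf (\<lambda>T. row T r) (random_unitriangular N) = pmf_of_set (leading_one_vecs N r)"
proof -
  define A where "A = {(r, c). r < c \<and> c < N}"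
  define A' where "A' = {r} \<times> {r<..<N}"
  define h where "h = (\<lambda>t. vec N (\<lambda>c. if r = c then 1 else if r < c then t (r, c) else 0 :: bit))"
  have fin: "finite A" by (rule finite_subset[of _ "{..<N} \<times> {..<N}"]) (auto simp: A_def)
  have sub: "A' \<subseteq> A" by (auto simp: A_def A'_def)
  \<comment> \<open>Overwriting the coins outside \<open>A'\<close> by 0 does not change row
    \<open>r\<close>. The value 0 has to agree with the default of \<open>Pi_pmf\<close>, since
    \<open>Pi_pmf_subset\<close> restricts a product in exactly this form.\<close>
  have row: "row (unitriangular_mat N t) r = h (\<lambda>x. if x \<in> A' then t x else 0)" for t
    using r by (auto simp: unitriangular_mat_def h_def A'_def intro!: eq_vecI)
  have "map_pmf (\<lambda>T. row T r) (random_unitriangular N)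
      = map_pmf h (Pi_pmf A' 0 (\<lambda>_. pmf_of_set UNIV))"
    unfolding random_unitriangular_def bernoulli_half_bit Pi_pmf_subset[OF fin sub]
    by (simp add: map_pmf_comp row A_def)
  also have "\<dots> = map_pmf h (pmf_of_set (PiE_dflt A' 0 (\<lambda>_. UNIV)))"
    using finite_subset[OF sub fin] by (simp add: Pi_pmf_of_set finite_bit)
  also have "\<dots> = pmf_of_set (leading_one_vecs N r)"
  proof (rule map_pmf_of_set_bij_betw)
    show "bij_betw h (PiE_dflt A' 0 (\<lambda>_. UNIV)) (leading_one_vecs N r)"
    \<comment> \<open>The inverse reads the coins back from the entries of the row beyond position
      \<open>r\<close>.\<close>
    proof (rule bij_betw_byWitness[where f' = "\<lambda>x p. if p \<in> A' then x $ snd p else 0"])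
      show "\<forall>t\<in>PiE_dflt A' 0 (\<lambda>_. UNIV). (\<lambda>p. if p \<in> A' then h t $ snd p else 0) = t"
        by (auto simp: h_def A'_def PiE_dflt_def fun_eq_iff)
      show "\<forall>x\<in>leading_one_vecs N r. h (\<lambda>p. if p \<in> A' then x $ snd p else 0) = x"
        by (auto simp: h_def A'_def leading_one_vecs_def intro!: eq_vecI)
      show "h ` PiE_dflt A' 0 (\<lambda>_. UNIV) \<subseteq> leading_one_vecs N r"
        using r by (auto simp: h_def leading_one_vecs_def)
    qed (auto simp: PiE_dflt_def)
  qed (use finite_subset[OF sub fin] in \<open>auto simp: finite_bit\<close>)
  finally show ?thesis .
qed

section \<open>The polar transform as a bijection on vectors\<close>

definition polar_encode :: "nat \<Rightarrow> bit vec \<Rightarrow> bit vec" where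
  "polar_encode m x = transpose_mat (polar_mat m) *\<^sub>v x"

lemma polar_mat_carrier [simp]: "polar_mat m \<in> carrier_mat (2 ^ m) (2 ^ m)"
proof -
  have "kronecker_power polar_kernel m \<in> carrier_mat (2 ^ m) (2 ^ m)"
    by (induction m) (auto simp: kronecker_mat_def polar_kernel_def mat_of_rows_list_def)
  then show ?thesis by (simp add: polar_mat_def)
qed

lemma dim_polar_mat [simp]: "dim_row (polar_mat m) = 2 ^ m" "dim_col (polar_mat m) = 2 ^ m"
  using carrier_matD[OF polar_mat_carrier] by auto

lemma polar_kernel_index [simp]:
  "polar_kernel $$ (0, 0) = 1" "polar_kernel $$ (0, Suc 0) = 0"
  "polar_kernel $$ (Suc 0, 0) = 1" "polar_kernel $$ (Suc 0, Suc 0) = 1"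
  "dim_row polar_kernel = 2" "dim_col polar_kernel = 2"
  by (auto simp: polar_kernel_def mat_of_rows_list_def)

lemma polar_mat_Suc_index:
  assumes "i < 2 * 2 ^ m" "j < 2 * 2 ^ m"
  shows "polar_mat (Suc m) $$ (i, j)
    = polar_kernel $$ (i div 2 ^ m, j div 2 ^ m) * polar_mat m $$ (i mod 2 ^ m, j mod 2 ^ m)"
  using assms dim_polar_mat[of m] by (simp add: polar_mat_def kronecker_mat_def)

text \<open>The new kernel is the left factor of the Kronecker product, so the quotient of an index
  by 2^m selects the block and the remainder the position inside it. The zero block comes from the
  upper right entry of the kernel.\<close>

lemma polar_mat_Suc:
  "polar_mat (Suc m)
    = four_block_mat (polar_mat m) (0\<^sub>m (2 ^ m) (2 ^ m)) (polar_mat m) (polar_mat m)"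
proof (rule eq_matI)
  let ?M = "2 ^ m :: nat"
  fix i j
  assume "i < dim_row (four_block_mat (polar_mat m) (0\<^sub>m ?M ?M) (polar_mat m) (polar_mat m))"
    "j < dim_col (four_block_mat (polar_mat m) (0\<^sub>m ?M ?M) (polar_mat m) (polar_mat m))"
  then have ij: "i < 2 * ?M" "j < 2 * ?M" by auto
  have dm: "k div ?M = (if k < ?M then 0 else 1) \<and> k mod ?M = (if k < ?M then k else k - ?M)"
    if "k < 2 * ?M" for k
  proof (cases "k < ?M")
    case False
    then show ?thesis using that by (simp add: le_div_geq le_mod_geq)
  qed simp
  show "polar_mat (Suc m) $$ (i, j)
    = four_block_mat (polar_mat m) (0\<^sub>m ?M ?M) (polar_mat m) (polar_mat m) $$ (i, j)"
    using ij dm[OF ij(1)] dm[OF ij(2)] by (simp add: polar_mat_Suc_index)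
qed auto

lemma polar_encode_carrier [simp]: "polar_encode m x \<in> carrier_vec (2 ^ m)"
  by (intro carrier_vecI) (simp add: polar_encode_def)

lemma polar_encode_zero [simp]: "polar_encode m (0\<^sub>v (2 ^ m)) = 0\<^sub>v (2 ^ m)"
  by (auto simp: polar_encode_def intro!: eq_vecI)

lemma polar_encode_0: "x \<in> carrier_vec 1 \<Longrightarrow> polar_encode 0 x = x"
  by (simp add: polar_encode_def polar_mat_def)

text \<open>Transposition moves the zero block to the lower left, so \<open>y\<close> reaches only
  the first half of the output while \<open>z\<close> reaches both.\<close>

lemma polar_encode_append:
  assumes "y \<in> carrier_vec (2 ^ m)" "z \<in> carrier_vec (2 ^ m)"
  shows "polar_encode (Suc m) (y @\<^sub>v z)
    = (polar_encode m y + polar_encode m z) @\<^sub>v polar_encode m z"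
proof -
  let ?P = "transpose_mat (polar_mat m)"
  have P: "?P \<in> carrier_mat (2 ^ m) (2 ^ m)" by simp
  have "polar_encode (Suc m) (y @\<^sub>v z)
      = four_block_mat ?P ?P (0\<^sub>m (2 ^ m) (2 ^ m)) ?P *\<^sub>v (y @\<^sub>v z)"
    unfolding polar_encode_def polar_mat_Suc
    using transpose_four_block_mat[OF polar_mat_carrier zero_carrier_mat polar_mat_carrier polar_mat_carrier]
    by simp
  also have "\<dots> = (?P *\<^sub>v y + ?P *\<^sub>v z) @\<^sub>v (0\<^sub>m (2 ^ m) (2 ^ m) *\<^sub>v y + ?P *\<^sub>v z)"
    by (rule four_block_mat_mult_vec[OF P P _ P assms]) simp
  also have "0\<^sub>m (2 ^ m) (2 ^ m) *\<^sub>v y = 0\<^sub>v (2 ^ m)"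
    using assms by (auto intro!: eq_vecI)
  finally show ?thesis
    using left_zero_vec[OF polar_encode_carrier, of m z] by (simp add: polar_encode_def)
qed

text \<open>The row vector product x F_N is expressed by \<open>polar_encode\<close> as a matrix
  acting on a column, hence the transpose there and the commuted scalar product here.\<close>

lemma row_mult_polar_mat:
  assumes "T \<in> carrier_mat (2 ^ m) (2 ^ m)" "r < 2 ^ m"
  shows "row (T * polar_mat m) r = polar_encode m (row T r)"
proof (rule eq_vecI)
  fix j assume "j < dim_vec (polar_encode m (row T r))"
  then have j: "j < 2 ^ m" by (simp add: polar_encode_def)
  have "row (T * polar_mat m) r $ j = row T r \<bullet> col (polar_mat m) j"
    using assms j by simp
  also have "\<dots> = col (polar_mat m) j \<bullet> row T r"
    using assms by (intro comm_scalar_prod[of _ "2 ^ m"] carrier_vecI) auto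
  also have "\<dots> = polar_encode m (row T r) $ j"
    using j by (simp add: polar_encode_def)
  finally show "row (T * polar_mat m) r $ j = polar_encode m (row T r) $ j" .
qed (simp add: polar_encode_def)

text \<open>This is \<open>row_mult_polar_mat\<close> for the identity matrix. It lets w(f_N^(i)) be
  compared with the weights of other encoded vectors.\<close>

lemma polar_row_eq_encode:
  assumes "1 \<le> i" "i \<le> 2 ^ m"
  shows "polar_row m i = polar_encode m (unit_vec (2 ^ m) (i - 1))"
proof -
  have "i - 1 < 2 ^ m" using assms by linarith
  then show ?thesis
    using row_mult_polar_mat[of "1\<^sub>m (2 ^ m)" m "i - 1"] polar_mat_carrier[of m]
    by (simp add: polar_row_def)
qed

lemma split_power_vec:
  assumes "x \<in> carrier_vec (2 ^ Suc m)"
  obtains y z where "x = y @\<^sub>v z" "y \<in> carrier_vec (2 ^ m)" "z \<in> carrier_vec (2 ^ m)"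
proof
  show "x = vec_first x (2 ^ m) @\<^sub>v vec_last x (2 ^ m)"
    using assms vec_first_last_append[of x "2 ^ m" "2 ^ m"] by (simp add: mult_2)
qed simp_all

text \<open>The second half of the output determines \<open>z\<close> by induction; cancelling its
  encoding from the first half then determines \<open>y\<close>.\<close>

lemma inj_on_polar_encode: "inj_on (polar_encode m) (carrier_vec (2 ^ m))"
proof (induction m)
  case 0
  then show ?case by (auto simp: inj_on_def polar_encode_0)
next
  case (Suc m)
  show ?case
  proof (rule inj_onI)
    fix x x' assume x: "x \<in> carrier_vec (2 ^ Suc m)" and x': "x' \<in> carrier_vec (2 ^ Suc m)"
      and eq: "polar_encode (Suc m) x = polar_encode (Suc m) x'"
    from x obtain y z where yz: "x = y @\<^sub>v z" "y \<in> carrier_vec (2 ^ m)" "z \<in> carrier_vec (2 ^ m)"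
      by (rule split_power_vec)
    from x' obtain y' z' where yz': "x' = y' @\<^sub>v z'" "y' \<in> carrier_vec (2 ^ m)" "z' \<in> carrier_vec (2 ^ m)"
      by (rule split_power_vec)
    have e: "polar_encode m y + polar_encode m z = polar_encode m y' + polar_encode m z'
      \<and> polar_encode m z = polar_encode m z'"
      using eq unfolding yz(1) yz'(1)
        polar_encode_append[OF yz(2,3)] polar_encode_append[OF yz'(2,3)]
      by (subst (asm) append_vec_eq[of _ "2 ^ m"]) auto
    then have "polar_encode m y = polar_encode m y'"
      by (metis add_right_cancel_vec polar_encode_carrier)
    then show "x = x'" using e Suc yz yz' by (auto dest: inj_onD)
  qed
qed

lemma bij_betw_polar_encode: "bij_betw (polar_encode m) (carrier_vec (2 ^ m)) (carrier_vec (2 ^ m))"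
  unfolding bij_betw_def
  by (intro conjI inj_on_polar_encode endo_inj_surj) auto

section \<open>Weights of encoded vectors\<close>

lemma hamming_weight_zero [simp]: "hamming_weight (0\<^sub>v n) = 0"
  by (simp add: hamming_weight_def)

lemma hamming_weight_encode_append:
  assumes "y \<in> carrier_vec (2 ^ m)" "z \<in> carrier_vec (2 ^ m)"
  shows "hamming_weight (polar_encode (Suc m) (y @\<^sub>v z))
    = hamming_weight (polar_encode m y + polar_encode m z) + hamming_weight (polar_encode m z)"
  by (simp add: polar_encode_append[OF assms] hamming_weight_append)

lemma hamming_weight_encode_high:
  assumes "z \<in> carrier_vec (2 ^ m)"
  shows "hamming_weight (polar_encode (Suc m) (0\<^sub>v (2 ^ m) @\<^sub>v z))
    = 2 * hamming_weight (polar_encode m z)"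
  using left_zero_vec[OF polar_encode_carrier, of m z]
  by (simp add: hamming_weight_encode_append assms)

text \<open>The second half of the unit vector is zero, so its encoding is the shorter row followed
  by zeros. Hence the lower summation limit in (a), written with the row of length 2^m, equals the
  weight of the row of length 2^(m-1).\<close>

lemma hamming_weight_encode_unit_low:
  assumes "r < 2 ^ m"
  shows "hamming_weight (polar_encode (Suc m) (unit_vec (2 ^ Suc m) r))
    = hamming_weight (polar_encode m (unit_vec (2 ^ m) r))"
proof -
  have "unit_vec (2 ^ Suc m) r = unit_vec (2 ^ m) r @\<^sub>v (0\<^sub>v (2 ^ m) :: bit vec)"
    using assms by (intro eq_vecI) auto
  then show ?thesis
    using right_zero_vec[OF polar_encode_carrier, of m "unit_vec (2 ^ m) r"]
    by (simp add: hamming_weight_encode_append)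
qed

lemma hamming_weight_encode_unit_high:
  assumes "r < 2 ^ m"
  shows "hamming_weight (polar_encode (Suc m) (unit_vec (2 ^ Suc m) (2 ^ m + r)))
    = 2 * hamming_weight (polar_encode m (unit_vec (2 ^ m) r))"
proof -
  have "unit_vec (2 ^ Suc m) (2 ^ m + r) = 0\<^sub>v (2 ^ m) @\<^sub>v (unit_vec (2 ^ m) r :: bit vec)"
    using assms by (intro eq_vecI) auto
  then show ?thesis by (simp add: hamming_weight_encode_high)
qed

text \<open>Case rule for the inductions on \<open>m\<close> below: the induction hypothesis applies
  to \<open>y\<close> in the first case and to \<open>z\<close> in the second.\<close>

lemma leading_one_vecs_Suc_cases:
  assumes "r < 2 ^ Suc m" "x \<in> leading_one_vecs (2 ^ Suc m) r"
  obtains (low) y z where "r < 2 ^ m" "x = y @\<^sub>v z" "y \<in> leading_one_vecs (2 ^ m) r"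
      "y \<in> carrier_vec (2 ^ m)" "z \<in> carrier_vec (2 ^ m)"
  | (high) r' z where "r = 2 ^ m + r'" "r' < 2 ^ m" "x = 0\<^sub>v (2 ^ m) @\<^sub>v z"
      "z \<in> leading_one_vecs (2 ^ m) r'" "z \<in> carrier_vec (2 ^ m)"
proof (cases "r < 2 ^ m")
  case True
  have "x \<in> carrier_vec (2 ^ Suc m)" using assms leading_one_vecs_carrier by blast
  then obtain y z where "x = y @\<^sub>v z" "y \<in> carrier_vec (2 ^ m)" "z \<in> carrier_vec (2 ^ m)"
    by (rule split_power_vec)
  with assms(2) True low show ?thesis
    by (simp add: leading_one_vecs_append_low mult_2)
next
  case False
  then have r: "r = 2 ^ m + (r - 2 ^ m)" "r - 2 ^ m < 2 ^ m" using assms(1) by auto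
  have "x \<in> leading_one_vecs (2 ^ m + 2 ^ m) (2 ^ m + (r - 2 ^ m))"
    using assms(2) r(1) by (simp add: mult_2)
  then obtain z where "x = 0\<^sub>v (2 ^ m) @\<^sub>v z" "z \<in> leading_one_vecs (2 ^ m) (r - 2 ^ m)"
    unfolding leading_one_vecs_high[OF r(2)] by auto
  with high[OF r] leading_one_vecs_carrier show ?thesis by blast
qed

text \<open>Shows that starting the sum in (a) at w(f_N^(i)) loses no term. For a leading one in the
  first half, w(a + v) + w(v) is at least w(a); for one in the second half, both weights
  double.\<close>

lemma hamming_weight_encode_ge_unit:
  assumes "r < 2 ^ m" "x \<in> leading_one_vecs (2 ^ m) r"
  shows "hamming_weight (polar_encode m (unit_vec (2 ^ m) r)) \<le> hamming_weight (polar_encode m x)"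
  using assms
proof (induction m arbitrary: r x)
  case 0
  then have "x = unit_vec 1 0" by (auto simp: leading_one_vecs_def intro!: eq_vecI)
  then show ?case using 0 by simp
next
  case (Suc m)
  from Suc.prems show ?case
  proof (cases rule: leading_one_vecs_Suc_cases)
    case (low y z)
    have "hamming_weight (polar_encode m (unit_vec (2 ^ m) r)) \<le> hamming_weight (polar_encode m y)"
      using low by (intro Suc.IH)
    then show ?thesis
      using low hamming_weight_add_bit[of "polar_encode m y" "2 ^ m" "polar_encode m z"]
        hamming_weight_encode_unit_low[of r m]
      by (simp add: hamming_weight_encode_append)
  next
    case (high r' z)
    then show ?thesis
      using Suc.IH[of r' z] hamming_weight_encode_unit_high[of r' m]
      by (simp add: hamming_weight_encode_high)
  qed
qed

text \<open>A leading one in the first half keeps \<open>r\<close> and changes the weight by an even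
  amount, by \<open>hamming_weight_add_bit\<close>. A leading one in the second half makes the
  weight even and \<open>r\<close> positive. Only the vector of length 1 starts with odd weight, at
  \<open>r\<close> = 0.\<close>

lemma even_hamming_weight_encode_iff:
  assumes "r < 2 ^ m" "x \<in> leading_one_vecs (2 ^ m) r"
  shows "even (hamming_weight (polar_encode m x)) \<longleftrightarrow> r \<noteq> 0"
  using assms
proof (induction m arbitrary: r x)
  case 0
  then have "x = unit_vec 1 0" by (auto simp: leading_one_vecs_def intro!: eq_vecI)
  moreover have "{k. k < Suc 0 \<and> unit_vec (Suc 0) 0 $ k = (1 :: bit)} = {0}" by auto
  ultimately show ?case using 0 by (simp add: polar_encode_0 hamming_weight_def)
next
  case (Suc m)
  from Suc.prems show ?case
  proof (cases rule: leading_one_vecs_Suc_cases)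
    case (low y z)
    have "even (hamming_weight (polar_encode (Suc m) x)) = even (hamming_weight (polar_encode m y))"
      using low hamming_weight_add_bit[of "polar_encode m y" "2 ^ m" "polar_encode m z"]
      by (simp add: hamming_weight_encode_append)
    then show ?thesis using low Suc.IH by blast
  next
    case (high r' z)
    then show ?thesis by (simp add: hamming_weight_encode_high)
  qed
qed

section \<open>The weight probabilities: counting, recursion, parity and initial values\<close>

lemma weight_prob_eq_card:
  assumes "1 \<le> i" "i \<le> 2 ^ m"
  shows "weight_prob m i d =
    card {x \<in> leading_one_vecs (2 ^ m) (i - 1). hamming_weight (polar_encode m x) = d}
      / card (leading_one_vecs (2 ^ m) (i - 1))"
proof -
  let ?U = "leading_one_vecs (2 ^ m) (i - 1)" and ?B = "{x. hamming_weight (polar_encode m x) = d}"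
  have r: "i - 1 < 2 ^ m" using assms by linarith
  have "?U \<noteq> {}" using unit_vec_leading_one[OF r] by blast
  \<comment> \<open>The two events agree only for matrices of the right dimensions, so they are
    compared after being pulled back along \<open>unitriangular_mat\<close>.\<close>
  have eq: "unitriangular_mat (2 ^ m) -` {T. hamming_weight (row (T * polar_mat m) (i - 1)) = d}
      = unitriangular_mat (2 ^ m) -` (\<lambda>T. row T (i - 1)) -` ?B"
  proof -
    have "unitriangular_mat (2 ^ m) t \<in> carrier_mat (2 ^ m) (2 ^ m)" for t :: "nat \<times> nat \<Rightarrow> bit"
      unfolding unitriangular_mat_def by (rule mat_carrier)
    from row_mult_polar_mat[OF this r] show ?thesis by (simp add: vimage_def)
  qed
  have "weight_prob m i d = measure_pmf.prob (random_unitriangular (2 ^ m)) ((\<lambda>T. row T (i - 1)) -` ?B)"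
    unfolding weight_prob_def random_unitriangular_def measure_map_pmf eq ..
  also have "\<dots> = measure_pmf.prob (pmf_of_set ?U) ?B"
    unfolding row_random_unitriangular[OF r, symmetric] measure_map_pmf ..
  also have "\<dots> = card (?U \<inter> ?B) / card ?U"
    using \<open>?U \<noteq> {}\<close> by (intro measure_pmf_of_set) auto
  also have "?U \<inter> ?B = {x \<in> ?U. hamming_weight (polar_encode m x) = d}" by auto
  finally show ?thesis .
qed

text \<open>The free second half multiplies the number of possible rows by 2^(2^m), which is the
  denominator in (a).\<close>

lemma bij_betw_append_leading_one_vecs:
  assumes "r < 2 ^ m"
  shows "bij_betw (\<lambda>(y, z). y @\<^sub>v z) (leading_one_vecs (2 ^ m) r \<times> carrier_vec (2 ^ m))
    (leading_one_vecs (2 ^ Suc m) r)"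
  unfolding bij_betw_def
proof
  show "inj_on (\<lambda>(y, z). y @\<^sub>v z) (leading_one_vecs (2 ^ m) r \<times> carrier_vec (2 ^ m))"
  proof (intro inj_onI, clarify)
    fix y z y' z'
    assume "y \<in> leading_one_vecs (2 ^ m) r" "y' \<in> leading_one_vecs (2 ^ m) r"
      and eq: "y @\<^sub>v z = y' @\<^sub>v z'"
    then have "y \<in> carrier_vec (2 ^ m)" "y' \<in> carrier_vec (2 ^ m)"
      using leading_one_vecs_carrier by blast+
    from append_vec_eq[OF this] eq show "y = y' \<and> z = z'" by simp
  qed
  have "y @\<^sub>v z \<in> leading_one_vecs (2 ^ Suc m) r"
    if "y \<in> leading_one_vecs (2 ^ m) r" "z \<in> carrier_vec (2 ^ m)" for y z
  proof -
    have "y \<in> carrier_vec (2 ^ m)" using that(1) leading_one_vecs_carrier by blast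
    from leading_one_vecs_append_low[OF assms this that(2)] that(1) show ?thesis
      by (simp add: mult_2)
  qed
  moreover have "x \<in> (\<lambda>(y, z). y @\<^sub>v z) ` (leading_one_vecs (2 ^ m) r \<times> carrier_vec (2 ^ m))"
    if x: "x \<in> leading_one_vecs (2 ^ Suc m) r" for x
  proof -
    have "r < 2 ^ Suc m" using assms by simp
    from this x show ?thesis
    proof (cases rule: leading_one_vecs_Suc_cases)
      case (low y z)
      then show ?thesis by (intro image_eqI[of _ _ "(y, z)"]) simp_all
    qed (use assms in simp)
  qed
  ultimately show "(\<lambda>(y, z). y @\<^sub>v z) ` (leading_one_vecs (2 ^ m) r \<times> carrier_vec (2 ^ m))
      = leading_one_vecs (2 ^ Suc m) r"
    by (intro equalityI subsetI) auto
qed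

text \<open>Pairs (y, z) of halves are counted. For fixed \<open>y\<close> the number of suitable
  \<open>z\<close> depends only on the weight of the encoding of \<open>y\<close>, so grouping the
  \<open>y\<close> by this weight d' gives the sum.\<close>

lemma weight_prob_low:
  fixes m i d :: nat
  assumes "1 \<le> i" "i \<le> 2 ^ m"
  defines "D \<equiv> {d'. hamming_weight (polar_row (Suc m) i) \<le> d' \<and> d' \<le> d \<and> even (d - d')}"
  shows "weight_prob (Suc m) i d = (\<Sum>d'\<in>D. weight_prob m i d' *
    (2 ^ d' * real (binom (2 ^ m - int d') ((d - d') div 2)) / 2 ^ 2 ^ m))"
proof -
  define U where "U = leading_one_vecs (2 ^ m) (i - 1)"
  define w where "w = (\<lambda>y. hamming_weight (polar_encode m y))"
  define f where "f = (\<lambda>d'. 2 ^ d' * binom (2 ^ m - int d') ((d - d') div 2))"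
  let ?C = "carrier_vec (2 ^ m) :: bit vec set"
  have r: "i - 1 < 2 ^ m" using assms(1,2) by linarith
  have i: "i \<le> 2 ^ Suc m" using assms(2) by simp
  note bij = bij_betw_append_leading_one_vecs[OF r, folded U_def]
  have finD: "finite D" by (rule finite_subset[of _ "{..d}"]) (auto simp: D_def)
  have UC: "y \<in> ?C" if "y \<in> U" for y
    using that leading_one_vecs_carrier by (auto simp: U_def)

  have fibre: "card {z \<in> ?C. hamming_weight (polar_encode m y + polar_encode m z) + w z = d}
      = (if w y \<in> D then f (w y) else 0)" if y: "y \<in> U" for y
  proof -
    \<comment> \<open>Since encoding is a bijection, v = z F_N may be taken as the free variable in
      place of \<open>z\<close>.\<close>
    have "bij_betw (polar_encode m)
        {z \<in> ?C. hamming_weight (polar_encode m y + polar_encode m z) + w z = d}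
        {v \<in> ?C. hamming_weight (polar_encode m y + v) + hamming_weight v = d}"
      using bij_betw_polar_encode by (rule bij_betw_Collect) (simp add: w_def)
    then have "card {z \<in> ?C. hamming_weight (polar_encode m y + polar_encode m z) + w z = d}
        = (if w y \<le> d \<and> even (d - w y)
           then 2 ^ w y * ((2 ^ m - w y) choose ((d - w y) div 2)) else 0)"
      unfolding w_def card_add_weight_eq[OF polar_encode_carrier, symmetric]
      by (rule bij_betw_same_card)
    \<comment> \<open>The lower limit in \<open>D\<close> holds automatically, by
      \<open>hamming_weight_encode_ge_unit\<close>.\<close>
    moreover have "w y \<in> D \<longleftrightarrow> w y \<le> d \<and> even (d - w y)"
      using hamming_weight_encode_ge_unit[OF r y[unfolded U_def]]
      unfolding D_def w_def mem_Collect_eq polar_row_eq_encode[OF assms(1) i]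
        hamming_weight_encode_unit_low[OF r] by blast
    \<comment> \<open>A weight never exceeds the length 2^m, so the integer difference is
      nonnegative and agrees with the truncated one.\<close>
    moreover have "binom (2 ^ m - int (w y)) k = (2 ^ m - w y) choose k" for k
    proof -
      have le: "w y \<le> 2 ^ m" by (simp add: w_def hamming_weight_le)
      then have "2 ^ m - int (w y) = int (2 ^ m - w y)" by (simp add: of_nat_diff)
      then show ?thesis by (simp add: binom_def)
    qed
    ultimately show ?thesis unfolding f_def by presburger
  qed

  have "card {x \<in> leading_one_vecs (2 ^ Suc m) (i - 1). hamming_weight (polar_encode (Suc m) x) = d}
      = card {p \<in> U \<times> ?C. hamming_weight (polar_encode m (fst p) + polar_encode m (snd p)) + w (snd p) = d}"
  proof (rule bij_betw_same_card[symmetric], rule bij_betw_Collect[OF bij])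
    fix p assume p: "p \<in> U \<times> ?C"
    then obtain y z where "p = (y, z)" "y \<in> ?C" "z \<in> ?C" using UC by blast
    then show "(hamming_weight (polar_encode (Suc m) (case p of (y, z) \<Rightarrow> y @\<^sub>v z)) = d) \<longleftrightarrow>
        (hamming_weight (polar_encode m (fst p) + polar_encode m (snd p)) + w (snd p) = d)"
      by (simp add: hamming_weight_encode_append w_def)
  qed
  also have "{p \<in> U \<times> ?C. hamming_weight (polar_encode m (fst p) + polar_encode m (snd p)) + w (snd p) = d}
      = (SIGMA y:U. {z \<in> ?C. hamming_weight (polar_encode m y + polar_encode m z) + w z = d})"
    by auto
  also have "card \<dots> = (\<Sum>y\<in>U. card {z \<in> ?C. hamming_weight (polar_encode m y + polar_encode m z) + w z = d})"
    by (rule card_SigmaI) (auto simp: U_def)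
  also have "\<dots> = (\<Sum>y\<in>U. if w y \<in> D then f (w y) else 0)"
    by (intro sum.cong refl fibre)
  also have "\<dots> = (\<Sum>y\<in>{y\<in>U. w y \<in> D}. f (w y))"
    by (rule sum.inter_filter[symmetric]) (simp add: U_def)
  \<comment> \<open>The summand depends on \<open>y\<close> only through \<open>w y\<close>, so each
    fibre of \<open>w\<close> contributes its cardinality times a constant.\<close>
  also have "\<dots> = (\<Sum>d'\<in>D. \<Sum>y\<in>{y\<in>{y\<in>U. w y \<in> D}. w y = d'}. f (w y))"
    by (rule sum.group[symmetric]) (auto simp: U_def finD)
  also have "\<dots> = (\<Sum>d'\<in>D. card {y\<in>U. w y = d'} * f d')"
  proof (rule sum.cong)
    fix d' assume "d' \<in> D"
    then have "{y\<in>{y\<in>U. w y \<in> D}. w y = d'} = {y\<in>U. w y = d'}" by auto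
    then show "(\<Sum>y\<in>{y\<in>{y\<in>U. w y \<in> D}. w y = d'}. f (w y)) = card {y\<in>U. w y = d'} * f d'"
      by simp
  qed simp
  finally have num: "card {x \<in> leading_one_vecs (2 ^ Suc m) (i - 1).
      hamming_weight (polar_encode (Suc m) x) = d} = (\<Sum>d'\<in>D. card {y\<in>U. w y = d'} * f d')" .
  have den: "card (leading_one_vecs (2 ^ Suc m) (i - 1)) = card U * 2 ^ 2 ^ m"
    using bij_betw_same_card[OF bij] by (simp add: card_cartesian_product card_carrier_bit_vec)
  have "weight_prob (Suc m) i d
      = real (\<Sum>d'\<in>D. card {y\<in>U. w y = d'} * f d') / real (card U * 2 ^ 2 ^ m)"
    unfolding weight_prob_eq_card[OF assms(1) i] num den ..
  also have "\<dots> = (\<Sum>d'\<in>D. (card {y\<in>U. w y = d'} / card U) * (f d' / 2 ^ 2 ^ m))"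
    unfolding of_nat_sum sum_divide_distrib by (intro sum.cong) simp_all
  finally show ?thesis
    unfolding weight_prob_eq_card[OF assms(1,2)] U_def w_def f_def by simp
qed

text \<open>The first half of the row is zero, so the encoding is z F_N written twice and its weight
  is doubled. The map from \<open>z\<close> to the row is injective, so the ratio of cardinalities
  is that of the shorter length.\<close>

lemma weight_prob_high:
  assumes "2 ^ m < i" "i \<le> 2 ^ Suc m"
  shows "weight_prob (Suc m) i d = (if even d then weight_prob m (i - 2 ^ m) (d div 2) else 0)"
proof -
  \<comment> \<open>The position of the leading one inside the second half, counted from 0.\<close>
  define r where "r = i - 2 ^ m - 1"
  let ?U = "leading_one_vecs (2 ^ m) r" and ?e = "\<lambda>z. 0\<^sub>v (2 ^ m) @\<^sub>v z :: bit vec"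
  have i: "i - 1 = 2 ^ m + r" "i - 2 ^ m - 1 = r" "r < 2 ^ m" "1 \<le> i" "1 \<le> i - 2 ^ m" "i - 2 ^ m \<le> 2 ^ m"
    using assms by (auto simp: r_def)
  have U: "leading_one_vecs (2 ^ Suc m) (i - 1) = ?e ` ?U"
    using leading_one_vecs_high[OF i(3)] unfolding i(1) by (simp add: mult_2)
  have inj: "inj_on ?e A" for A
    by (auto simp: inj_on_def append_vec_eq[of _ "2 ^ m"])
  have "hamming_weight (polar_encode (Suc m) (?e z)) = 2 * hamming_weight (polar_encode m z)"
    if "z \<in> ?U" for z
    using that leading_one_vecs_carrier by (intro hamming_weight_encode_high) blast
  then have "{x \<in> ?e ` ?U. hamming_weight (polar_encode (Suc m) x) = d}
      = ?e ` {z \<in> ?U. 2 * hamming_weight (polar_encode m z) = d}"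
    by auto
  then have "weight_prob (Suc m) i d
      = card {z \<in> ?U. 2 * hamming_weight (polar_encode m z) = d} / card ?U"
    unfolding weight_prob_eq_card[OF i(4) assms(2)] U by (simp add: card_image[OF inj])
  moreover have "{z \<in> ?U. 2 * hamming_weight (polar_encode m z) = d}
      = (if even d then {z \<in> ?U. hamming_weight (polar_encode m z) = d div 2} else {})"
    by auto
  ultimately show ?thesis
    unfolding weight_prob_eq_card[OF i(5,6)] i(2) by simp
qed

text \<open>The equivalence in the hypothesis covers both impossible cases of (d): even
  \<open>d\<close> with \<open>i\<close> = 1, and odd \<open>d\<close> with \<open>i\<close> >
  1.\<close>

lemma weight_prob_parity:
  assumes "1 \<le> i" "i \<le> 2 ^ m" "even d \<longleftrightarrow> i = 1"
  shows "weight_prob m i d = 0"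
proof -
  have "i - 1 < 2 ^ m" using assms by linarith
  then have "{x \<in> leading_one_vecs (2 ^ m) (i - 1). hamming_weight (polar_encode m x) = d} = {}"
    using even_hamming_weight_encode_iff assms(1,3) by fastforce
  then show ?thesis unfolding weight_prob_eq_card[OF assms(1,2)] by simp
qed

lemma weight_prob_eq_1:
  assumes "1 \<le> i" "i \<le> 2 ^ m"
    and "\<And>x. x \<in> leading_one_vecs (2 ^ m) (i - 1) \<Longrightarrow> hamming_weight (polar_encode m x) = d"
  shows "weight_prob m i d = 1"
proof -
  have "i - 1 < 2 ^ m" using assms(1,2) by linarith
  then have "leading_one_vecs (2 ^ m) (i - 1) \<noteq> {}" using unit_vec_leading_one by blast
  moreover have "{x \<in> leading_one_vecs (2 ^ m) (i - 1). hamming_weight (polar_encode m x) = d}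
      = leading_one_vecs (2 ^ m) (i - 1)"
    using assms(3) by auto
  ultimately show ?thesis unfolding weight_prob_eq_card[OF assms(1,2)] by simp
qed

text \<open>The weight is odd and at most 2.\<close>

lemma weight_prob_1_1: "weight_prob 1 1 1 = 1"
proof (rule weight_prob_eq_1)
  fix x assume "x \<in> leading_one_vecs (2 ^ 1) (1 - 1)"
  then have "odd (hamming_weight (polar_encode 1 x))"
    using even_hamming_weight_encode_iff[of 0 1 x] by simp
  moreover have "hamming_weight (polar_encode 1 x) \<le> 2"
    using hamming_weight_le[OF polar_encode_carrier, of 1 x] by simp
  ultimately show "hamming_weight (polar_encode 1 x) = 1"
    by (cases "hamming_weight (polar_encode 1 x) = 2") (auto elim: oddE)
qed simp_all

text \<open>The recursion for the second half reduces this to length 1, where the weight is odd and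
  at most 1.\<close>

lemma weight_prob_1_2: "weight_prob 1 2 2 = 1"
proof -
  have "weight_prob 0 1 1 = 1"
  proof (rule weight_prob_eq_1)
    fix x assume "x \<in> leading_one_vecs (2 ^ 0) (1 - 1)"
    then have "odd (hamming_weight (polar_encode 0 x))"
      using even_hamming_weight_encode_iff[of 0 0 x] by simp
    moreover have "hamming_weight (polar_encode 0 x) \<le> 1"
      using hamming_weight_le[OF polar_encode_carrier, of 0 x] by simp
    ultimately show "hamming_weight (polar_encode 0 x) = 1"
      by (auto elim: oddE)
  qed simp_all
  then show ?thesis using weight_prob_high[of 0 2 2] by simp
qed

theorem theorem2:
  shows
    "(\<forall>m i d. 2 \<le> m \<and> 1 \<le> i \<and> i \<le> 2 ^ (m - 1) \<longrightarrow>
        weight_prob m i d =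
          (\<Sum>d' \<in> {d'. hamming_weight (polar_row m i) \<le> d' \<and> d' \<le> d \<and> even (d - d')}.
             weight_prob (m - 1) i d' *
               (2 ^ d' * real (binom (2 ^ (m - 1) - int d') ((d - d') div 2)) / 2 ^ 2 ^ (m - 1)))) \<and>
     (\<forall>m i d. 2 \<le> m \<and> 2 ^ (m - 1) < i \<and> i \<le> 2 ^ m \<longrightarrow>
        weight_prob m i d =
          (if even d then weight_prob (m - 1) (i - 2 ^ (m - 1)) (d div 2) else 0)) \<and>
     (weight_prob 1 1 1 = 1 \<and> weight_prob 1 2 2 = 1) \<and>
     (\<forall>m d. 1 \<le> m \<longrightarrow>
        (even d \<longrightarrow> weight_prob m 1 d = 0) \<and>
        (\<forall>i. 1 < i \<and> i \<le> 2 ^ m \<and> odd d \<longrightarrow> weight_prob m i d = 0))"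
proof (intro conjI allI impI)
  fix m i d :: nat
  assume "2 \<le> m \<and> 1 \<le> i \<and> i \<le> 2 ^ (m - 1)"
  then show "weight_prob m i d =
      (\<Sum>d' \<in> {d'. hamming_weight (polar_row m i) \<le> d' \<and> d' \<le> d \<and> even (d - d')}.
         weight_prob (m - 1) i d' *
           (2 ^ d' * real (binom (2 ^ (m - 1) - int d') ((d - d') div 2)) / 2 ^ 2 ^ (m - 1)))"
    using weight_prob_low[of i "m - 1" d] by (cases m) simp_all
next
  fix m i d :: nat
  assume "2 \<le> m \<and> 2 ^ (m - 1) < i \<and> i \<le> 2 ^ m"
  then show "weight_prob m i d =
      (if even d then weight_prob (m - 1) (i - 2 ^ (m - 1)) (d div 2) else 0)"
    using weight_prob_high[of "m - 1" i d] by (cases m) simp_all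
qed (use weight_prob_1_1 weight_prob_1_2 in \<open>auto simp: weight_prob_parity\<close>)

end
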